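(* We have $$\sum_{n\ge0}\sum_{0\le k\le n}a(n,k)t^kx^n=\frac{(1-3tx^2+t^2x^4)(1-tx^2)^2}{(1-tx-tx^2)(1-x-tx^2)(1-2tx^2)^2},$$ or equivalently $$\sum_{n\ge0}\sum_{0\le k\le n/2}a(n,k)t^kx^n=\frac{(1-tx^2)^3}{(1-x-tx^2)(1-2tx^2)^2}.$$
   Context: $\Bbbk$ is a field of characteristic $0$; $\mathcal{M}$ is the free monoid on letters $D,U$; $\mathcal{W}=\Bbbk\langle D,U\mid DU-UD=1\rangle$; $\phi:\mathcal{M}\to\mathcal{W}$ is the monoid morphism with $D\mapsto D,U\mapsto U$. Words $u,v$ are Weyl-equivalent if $\phi(u)=\phi(v)$. For $0\le k\le n$, $a(n,k)$ is the number of Weyl-equivalence classes of words with $k$ letters $D$ and $n-k$ letters $U$. The identities are of formal power series in $x,t$. *)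

theory Defs
  imports
    "HOL-Library.Poly_Mapping"
    "HOL-Computational_Algebra.Formal_Power_Series"
begin

datatype letter = D | U

text \<open>
  The free monoid on \<open>letter\<close> is \<open>letter list\<close> under concatenation.  It is written additively
  because the convolution product of \<^typ>\<open>'a \<Rightarrow>\<^sub>0 'b\<close> is indexed by a
  \<^class>\<open>monoid_add\<close>; nothing here is commutative.
\<close>

instantiation list :: (type) monoid_add
begin

definition zero_list :: "'a list" where "zero_list = []"

definition plus_list :: "'a list \<Rightarrow> 'a list \<Rightarrow> 'a list" where "plus_list = append"

instance
  by standard (simp_all add: zero_list_def plus_list_def)

end

type_synonym 'k free_algebra = "letter list \<Rightarrow>\<^sub>0 'k"

inductive_set two_sided_ideal :: "'r::ring_1 set \<Rightarrow> 'r set" for S where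
  generator: "s \<in> S \<Longrightarrow> s \<in> two_sided_ideal S"
| zero: "0 \<in> two_sided_ideal S"
| add: "a \<in> two_sided_ideal S \<Longrightarrow> b \<in> two_sided_ideal S \<Longrightarrow> a + b \<in> two_sided_ideal S"
| mult_left: "a \<in> two_sided_ideal S \<Longrightarrow> r * a \<in> two_sided_ideal S"
| mult_right: "a \<in> two_sided_ideal S \<Longrightarrow> a * r \<in> two_sided_ideal S"

lemma two_sided_ideal_uminus: "a \<in> two_sided_ideal S \<Longrightarrow> - a \<in> two_sided_ideal S"
  using two_sided_ideal.mult_left[of a S "- 1"] by simp

lemma two_sided_ideal_diff:
  "a \<in> two_sided_ideal S \<Longrightarrow> b \<in> two_sided_ideal S \<Longrightarrow> a - b \<in> two_sided_ideal S"
  using two_sided_ideal.add[of a S "- b"] two_sided_ideal_uminus[of b S] by simp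

abbreviation free_letter :: "letter \<Rightarrow> 'k::comm_ring_1 free_algebra" where
  "free_letter c \<equiv> Poly_Mapping.single [c] 1"

definition weyl_ideal :: "'k::comm_ring_1 free_algebra set" where
  "weyl_ideal = two_sided_ideal {free_letter D * free_letter U - free_letter U * free_letter D - 1}"

definition weyl_cong :: "'k::comm_ring_1 free_algebra \<Rightarrow> 'k free_algebra \<Rightarrow> bool" where
  "weyl_cong a b \<longleftrightarrow> a - b \<in> weyl_ideal"

lemma equivp_weyl_cong: "equivp (weyl_cong :: 'k::comm_ring_1 free_algebra \<Rightarrow> _)"
proof (rule equivpI)
  show "reflp (weyl_cong :: 'k free_algebra \<Rightarrow> _)"
    by (rule reflpI) (simp add: weyl_cong_def weyl_ideal_def two_sided_ideal.zero)
  show "symp (weyl_cong :: 'k free_algebra \<Rightarrow> _)"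
    by (rule sympI)
      (metis weyl_cong_def weyl_ideal_def minus_diff_eq two_sided_ideal_uminus)
  show "transp (weyl_cong :: 'k free_algebra \<Rightarrow> _)"
  proof (rule transpI)
    fix a b c :: "'k free_algebra"
    assume "weyl_cong a b" "weyl_cong b c"
    then have "(a - b) + (b - c) \<in> weyl_ideal"
      unfolding weyl_cong_def weyl_ideal_def by (rule two_sided_ideal.add)
    then show "weyl_cong a c" by (simp add: weyl_cong_def)
  qed
qed

quotient_type (overloaded) 'k weyl = "'k::comm_ring_1 free_algebra" / weyl_cong
  by (rule equivp_weyl_cong)

instantiation weyl :: (comm_ring_1) ring
begin

lift_definition zero_weyl :: "'a weyl" is 0 .

lift_definition plus_weyl :: "'a weyl \<Rightarrow> 'a weyl \<Rightarrow> 'a weyl" is "(+)"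
proof -
  fix a b c d :: "'a free_algebra"
  assume "weyl_cong a b" "weyl_cong c d"
  then have "(a - b) + (c - d) \<in> weyl_ideal"
    unfolding weyl_cong_def weyl_ideal_def by (rule two_sided_ideal.add)
  then show "weyl_cong (a + c) (b + d)" by (simp add: weyl_cong_def algebra_simps)
qed

lift_definition uminus_weyl :: "'a weyl \<Rightarrow> 'a weyl" is uminus
proof -
  fix a b :: "'a free_algebra"
  assume "weyl_cong a b"
  then have "- (a - b) \<in> weyl_ideal"
    unfolding weyl_cong_def weyl_ideal_def by (rule two_sided_ideal_uminus)
  then show "weyl_cong (- a) (- b)" by (simp add: weyl_cong_def)
qed

lift_definition minus_weyl :: "'a weyl \<Rightarrow> 'a weyl \<Rightarrow> 'a weyl" is "(-)"
proof -
  fix a b c d :: "'a free_algebra"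
  assume "weyl_cong a b" "weyl_cong c d"
  then have "(a - b) - (c - d) \<in> weyl_ideal"
    unfolding weyl_cong_def weyl_ideal_def by (rule two_sided_ideal_diff)
  then show "weyl_cong (a - c) (b - d)" by (simp add: weyl_cong_def algebra_simps)
qed

lift_definition times_weyl :: "'a weyl \<Rightarrow> 'a weyl \<Rightarrow> 'a weyl" is "(*)"
proof -
  fix a b c d :: "'a free_algebra"
  assume "weyl_cong a b" "weyl_cong c d"
  then have "(a - b) * c + b * (c - d) \<in> weyl_ideal"
    unfolding weyl_cong_def weyl_ideal_def
    by (intro two_sided_ideal.add two_sided_ideal.mult_left two_sided_ideal.mult_right)
  then show "weyl_cong (a * c) (b * d)" by (simp add: weyl_cong_def algebra_simps)
qed

instance
  by standard (transfer, simp add: algebra_simps equivp_reflp[OF equivp_weyl_cong])+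

end

instantiation weyl :: (comm_ring_1) monoid_mult
begin

lift_definition one_weyl :: "'a weyl" is 1 .

instance
  by standard (transfer, simp add: equivp_reflp[OF equivp_weyl_cong])+

end

lift_definition weyl_letter :: "letter \<Rightarrow> 'k::comm_ring_1 weyl" is free_letter .

definition phi :: "letter list \<Rightarrow> 'k::comm_ring_1 weyl" where
  "phi w = prod_list (map weyl_letter w)"

lemma phi_append: "phi (u @ v) = phi u * phi v"
  by (simp add: phi_def)

lemma weyl_relation:
  "weyl_letter D * weyl_letter U - weyl_letter U * weyl_letter D = (1 :: 'k::comm_ring_1 weyl)"
  by transfer (simp add: weyl_cong_def weyl_ideal_def two_sided_ideal.generator)

definition weyl_equiv :: "'k::comm_ring_1 itself \<Rightarrow> (letter list \<times> letter list) set" where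
  "weyl_equiv _ = {(u, v). phi u = (phi v :: 'k weyl)}"

definition num_weyl_classes :: "'k::comm_ring_1 itself \<Rightarrow> nat \<Rightarrow> nat \<Rightarrow> nat" where
  "num_weyl_classes K n k =
    card ({w. count_list w D = k \<and> count_list w U = n - k} // weyl_equiv K)"

text \<open>
  Power series in \<open>x\<close> and \<open>t\<close> are elements of \<open>\<rat>[[t]][[x]]\<close>: the outer variable is \<open>x\<close> and
  the inner one is \<open>t\<close>.
\<close>

abbreviation var_t :: "rat fps" where "var_t \<equiv> fps_X"

abbreviation ser_x :: "rat fps fps" where "ser_x \<equiv> fps_X"

abbreviation ser_t :: "rat fps fps" where "ser_t \<equiv> fps_const var_t"

text \<open>
  \<^typ>\<open>rat fps\<close> is not a field, but division in \<^typ>\<open>rat fps fps\<close> is the genuine one for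
  denominators with constant term 1.
\<close>

lemma fps_fps_divide_eq_iff:
  fixes f g h :: "rat fps fps"
  assumes "fps_nth g 0 = 1"
  shows "f / g = h \<longleftrightarrow> f = h * g"
proof -
  have inv: "inverse g * g = 1"
    using fps_right_inverse[of g 1] assms by (simp add: fps_inverse_def[of g] mult.commute)
  have "subdegree g = 0" using assms by simp
  moreover have "unit_factor g = g" using \<open>subdegree g = 0\<close> by simp
  ultimately have div: "f / g = f * inverse g" by (simp only: fps_divide_def fps_shift_0)
  have "f * inverse g * g = f" by (simp only: mult.assoc inv mult_1_right)
  moreover have "h * g * inverse g = h" by (simp only: mult.assoc mult.commute[of g] inv mult_1_right)
  ultimately show ?thesis unfolding div by metis
qed

end

theory Submission
  imports Defs "HOL-Computational_Algebra.Polynomial"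
begin

text \<open>
  A word with \<open>e\<close> more letters \<open>U\<close> than \<open>D\<close> acts on \<open>z\<^sup>m\<close>, with \<open>D\<close> as derivative and \<open>U\<close> as
  multiplication by \<open>z\<close>, as \<open>z\<^sup>m \<mapsto> (\<Prod>h. m + h) z\<^sup>m\<^sup>+\<^sup>e\<close>, where \<open>h\<close> runs over the starting heights of
  the down-steps of the associated lattice path.  Conversely the multiset of these heights
  determines the image of the word in the Weyl algebra, because \<open>UD + h\<close> and \<open>UD + h'\<close> commute.
  So classes are counted by multisets of levels.  For \<open>e \<ge> 0\<close> such a multiset consists of \<open>e\<close>
  arbitrary multiplicities and two compositions (the levels above \<open>e\<close> and below \<open>1\<close>), which gives
  \<open>(1 - y)\<^sup>2 / ((1 - y)\<^sup>e (1 - 2 y)\<^sup>2)\<close> with \<open>y = t x\<^sup>2\<close>, and \<open>e < 0\<close> follows by reflection.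
\<close>

section \<open>A faithful action on polynomials\<close>

lemma poly_mapping_single_induct [case_names single add]:
  fixes p :: "'a \<Rightarrow>\<^sub>0 'b::ab_group_add"
  assumes single: "\<And>k v. P (Poly_Mapping.single k v)"
    and add: "\<And>p q. P p \<Longrightarrow> P q \<Longrightarrow> P (p + q)"
  shows "P p"
proof (induction p rule: update_induct)
  case const
  show ?case using single[of undefined 0] by simp
next
  case (update f a b)
  have "Poly_Mapping.update a b f = f + Poly_Mapping.single a b"
    using update(1) by (intro poly_mapping_eqI)
      (auto simp: lookup_update lookup_add lookup_single in_keys_iff when_def)
  then show ?case using add[OF update(3) single[of a b]] by simp
qed

primrec word_act :: "letter list \<Rightarrow> 'k::idom poly \<Rightarrow> 'k poly" where
  "word_act [] f = f"
| "word_act (c # w) f = (case c of D \<Rightarrow> pderiv (word_act w f) | U \<Rightarrow> pCons 0 (word_act w f))"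

lemma word_act_append: "word_act (u @ v) f = word_act u (word_act v f)"
  by (induction u) (simp_all split: letter.split)

lemma word_act_0 [simp]: "word_act w 0 = 0"
  by (induction w) (simp_all split: letter.split)

lemma word_act_add: "word_act w (f + g) = word_act w f + word_act w g"
  by (induction w) (simp_all add: pderiv_add split: letter.split)

lemma word_act_smult: "word_act w (smult a f) = smult a (word_act w f)"
  by (induction w) (simp_all add: pderiv_smult split: letter.split)

definition free_act :: "'k::idom free_algebra \<Rightarrow> 'k poly \<Rightarrow> 'k poly" where
  "free_act p f = (\<Sum>w\<in>Poly_Mapping.keys p. smult (Poly_Mapping.lookup p w) (word_act w f))"

lemma free_act_single: "free_act (Poly_Mapping.single w a) f = smult a (word_act w f)"
  by (simp add: free_act_def)

lemma free_act_add: "free_act (p + q) f = free_act p f + free_act q f"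
  unfolding free_act_def
  by (rule setsum_keys_plus_distrib[where f = "\<lambda>w a. smult a (word_act w f)"])
    (simp_all add: smult_add_left)

lemma free_act_0 [simp]: "free_act 0 f = 0"
  by (simp add: free_act_def)

lemma free_act_diff: "free_act (p - q) f = free_act p f - free_act q f"
  using free_act_add[of "p - q" q f] by simp

lemma free_act_0_right [simp]: "free_act p 0 = 0"
  by (simp add: free_act_def)

lemma free_act_add_right: "free_act p (f + g) = free_act p f + free_act p g"
  by (simp add: free_act_def word_act_add smult_add_right sum.distrib)

text \<open>Both sides are additive in \<open>p\<close> and in \<open>q\<close>, which leaves single
  words, where the product is concatenation.\<close>

lemma free_act_mult: "free_act (p * q) f = free_act p (free_act q f)"
proof (induction p rule: poly_mapping_single_induct)
  case (single u a)
  show ?case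
  proof (induction q rule: poly_mapping_single_induct)
    case (single v b)
    then show ?case
      by (simp add: mult_single free_act_single word_act_append word_act_smult plus_list_def)
  next
    case (add p q)
    then show ?case by (simp add: distrib_left free_act_add free_act_add_right)
  qed
next
  case (add p q)
  then show ?case by (simp add: distrib_right free_act_add)
qed

lemma single_Nil: "Poly_Mapping.single [] 1 = 1"
  by (simp flip: zero_list_def)

lemma free_act_1: "free_act 1 f = f"
  using free_act_single[of "[]" 1 f] by (simp add: single_Nil)

text \<open>On the generator this is the product rule \<open>(z f)' - z f' = f\<close>. The
  polynomial is kept arbitrary because a right factor acts on it first.\<close>

lemma free_act_weyl_ideal:
  assumes "p \<in> weyl_ideal"
  shows "free_act p f = 0"
  using assms unfolding weyl_ideal_def
proof (induction arbitrary: f rule: two_sided_ideal.induct)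
  case (generator s)
  then show ?case
    by (simp add: free_act_diff free_act_mult free_act_single free_act_1 pderiv_pCons)
qed (simp_all add: free_act_add free_act_mult)

text \<open>The content is nontriviality: elements of the ideal act as zero, while \<open>1\<close>
  acts as the identity.\<close>

instance weyl :: (idom) ring_1
proof
  have "free_act (0 - 1 :: 'a free_algebra) 1 \<noteq> 0"
    by (simp only: free_act_diff free_act_1 free_act_0) simp
  then have "\<not> weyl_cong (0 :: 'a free_algebra) 1"
    unfolding weyl_cong_def using free_act_weyl_ideal by blast
  then show "(0 :: 'a weyl) \<noteq> 1"
    by transfer
qed

lemma phi_Cons: "phi (c # w) = weyl_letter c * phi w"
  by (simp add: phi_def)

lemma phi_eq_abs_weyl: "phi w = abs_weyl (Poly_Mapping.single w 1)"
proof (induction w)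
  case Nil
  then show ?case
    by (simp add: phi_def one_weyl_def single_Nil)
next
  case (Cons c w)
  then show ?case
    by (simp add: phi_Cons weyl_letter.abs_eq times_weyl.abs_eq mult_single plus_list_def)
qed

lemma phi_eq_imp_word_act_eq:
  assumes "phi u = (phi v :: 'k::idom weyl)"
  shows "word_act u (f :: 'k poly) = word_act v f"
proof -
  have "weyl_cong (Poly_Mapping.single u 1) (Poly_Mapping.single v (1 :: 'k))"
    using assms by (simp add: phi_eq_abs_weyl weyl.abs_eq_iff)
  then show ?thesis
    unfolding weyl_cong_def using free_act_weyl_ideal[of _ f]
    by (force simp: free_act_diff free_act_single)
qed

section \<open>Levels of a word\<close>

primrec height :: "letter list \<Rightarrow> int" where
  "height [] = 0"
| "height (c # w) = (case c of D \<Rightarrow> height w - 1 | U \<Rightarrow> height w + 1)"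

text \<open>
  Read a word from right to left as a lattice path, \<open>U\<close> going up and \<open>D\<close> going down.  Its levels
  are the upper ends of the down-steps above the axis and of the up-steps below it.  Recording
  all down-steps instead (\<open>descents\<close> below) gives the same information, since on each level the
  numbers of up-steps and down-steps differ by an amount that depends only on the final height.
\<close>

primrec levels :: "letter list \<Rightarrow> int multiset" where
  "levels [] = {#}"
| "levels (c # w) = (case c of
      D \<Rightarrow> if 0 < height w then add_mset (height w) (levels w) else levels w
    | U \<Rightarrow> if height w < 0 then add_mset (height w + 1) (levels w) else levels w)"

text \<open>A path ending below the axis leaves each level in \<open>{height w<..0}\<close>
  downwards once more than it enters it from below; hence the second summand.\<close>

definition descents :: "letter list \<Rightarrow> int multiset" where
  "descents w = levels w + mset_set {height w<..0}"

lemma descents_Nil [simp]: "descents [] = {#}"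
  by (simp add: descents_def)

lemma descents_D [simp]: "descents (D # w) = add_mset (height w) (descents w)"
proof (cases "0 < height w")
  case False
  then have "{height w - 1<..0} = insert (height w) {height w<..0}" by auto
  with False show ?thesis by (simp add: descents_def)
qed (simp add: descents_def)

lemma descents_U [simp]: "descents (U # w) = descents w"
proof (cases "height w < 0")
  case True
  then have "{height w<..0} = insert (height w + 1) {height w + 1<..0}" by auto
  with True show ?thesis by (simp add: descents_def)
qed (simp add: descents_def)

lemma abs_height_le: "\<bar>height w\<bar> \<le> int (length w)"
  by (induction w) (auto split: letter.split)

text \<open>The bound on \<open>m\<close> keeps every exponent positive before each letter acts, so
  no derivative kills the monomial and \<open>nat\<close> truncates nothing.\<close>

lemma word_act_monom:
  "length w \<le> m \<Longrightarrow> word_act w (monom (1 :: 'k::idom) m) =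
    monom (\<Prod>h\<in>#descents w. of_int (int m + h)) (nat (int m + height w))"
proof (induction w)
  case (Cons c w)
  then have IH: "word_act w (monom (1 :: 'k) m) =
      monom (\<Prod>h\<in>#descents w. of_int (int m + h)) (nat (int m + height w))"
    and pos: "0 < int m + height w"
    using abs_height_le[of w] by auto
  have of_nat: "(of_nat (nat (int m + height w)) :: 'k) = of_int (int m + height w)"
    using pos by simp
  show ?case
  proof (cases c)
    case D
    have "nat (int m + (height w - 1)) = nat (int m + height w) - 1" by simp
    then show ?thesis
      by (simp only: D word_act.simps letter.case IH pderiv_monom of_nat descents_D
          height.simps image_mset_add_mset prod_mset.add_mset)
  next
    case U
    have "nat (int m + (height w + 1)) = Suc (nat (int m + height w))" using pos by simp
    then show ?thesis
      by (simp only: U word_act.simps letter.case IH descents_U height.simps monom_Suc)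
  qed
qed simp

text \<open>Both products are polynomials in \<open>m\<close> that agree at infinitely many points,
  and their roots with multiplicity are the values \<open>- h\<close>.\<close>

lemma prod_mset_shift_inj:
  fixes M N :: "int multiset"
  assumes "\<And>m. m \<ge> n \<Longrightarrow>
    (\<Prod>h\<in>#M. of_int (int m + h)) = (\<Prod>h\<in>#N. of_int (int m + h) :: 'k::field_char_0)"
  shows "M = N"
proof -
  define p where "p = (\<lambda>M. \<Prod>h\<in>#M. [:of_int h :: 'k, 1:])"
  have poly_p: "poly (p M) (of_nat m) = (\<Prod>h\<in>#M. of_int (int m + h))" for M m
    by (simp add: p_def poly_prod_mset add.commute)
  have "infinite (of_nat ` {n..} :: 'k set)"
    by (simp add: finite_image_iff inj_on_def infinite_Ici)
  moreover have "of_nat ` {n..} \<subseteq> {x. poly (p M - p N) x = 0}"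
    using assms by (auto simp: poly_p)
  ultimately have "infinite {x. poly (p M - p N) x = 0}"
    by (meson finite_subset)
  then have "p M = p N"
    using poly_roots_finite[of "p M - p N"] by (metis right_minus_eq)
  moreover have "proots (p M) = image_mset (\<lambda>h. - of_int h) M" for M
  proof (induction M)
    case (add h M)
    have "p (add_mset h M) = [:of_int h, 1:] * p M" and "p M \<noteq> 0"
      by (auto simp: p_def)
    then show ?case by (simp add: proots_mult add del: mult_pCons_left)
  qed (simp add: p_def)
  ultimately have "image_mset (\<lambda>h. - of_int h :: 'k) M = image_mset (\<lambda>h. - of_int h) N"
    by metis
  moreover have "inj (\<lambda>h. - of_int h :: 'k)" by (simp add: inj_on_def)
  ultimately show ?thesis by (metis multiset.inj_map injD)
qed

lemma phi_eq_imp_levels_eq: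
  assumes "phi u = (phi v :: 'k::field_char_0 weyl)" and "height u = height v"
  shows "levels u = levels v"
proof -
  have "descents u = descents v"
  proof (rule prod_mset_shift_inj[where n = "max (length u) (length v)" and 'k = 'k])
    fix m assume "m \<ge> max (length u) (length v)"
    then show "(\<Prod>h\<in>#descents u. of_int (int m + h)) =
        (\<Prod>h\<in>#descents v. of_int (int m + h) :: 'k)"
      using phi_eq_imp_word_act_eq[OF assms(1), of "monom 1 m"] assms(2)
      by (simp add: word_act_monom)
  qed
  with assms(2) show ?thesis by (simp add: descents_def)
qed

text \<open>
  Modulo \<open>d u = u d + 1\<close>, \<open>E = u d\<close> satisfies \<open>d u\<^sup>e\<^sup>+\<^sup>1 = u\<^sup>e (E + e + 1)\<close> and
  \<open>u d\<^sup>e\<^sup>+\<^sup>1 = d\<^sup>e (E - e)\<close>, so every word is a power of one letter times a product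
  of commuting factors \<open>E + h\<close>, one for each level.
\<close>

lemma commute_power:
  fixes d u :: "'a::ring_1"
  assumes du: "d * u = u * d + 1"
  shows "d * u ^ Suc e = u ^ e * (u * d + of_nat (Suc e))"
    and "u * d ^ Suc e = d ^ e * (u * d - of_nat e)"
proof -
  have Eu: "u * d * u = u * (u * d + 1)" by (simp add: mult.assoc du)
  have dE: "d * (u * d) = (u * d + 1) * d" by (simp add: mult.assoc[symmetric] du)
  show "d * u ^ Suc e = u ^ e * (u * d + of_nat (Suc e))"
  proof (induction e)
    case (Suc e)
    have "d * u ^ Suc (Suc e) = d * u ^ Suc e * u" by (simp only: power_Suc2 mult.assoc)
    also have "\<dots> = u ^ e * (u * d * u + of_nat (Suc e) * u)"
      by (simp only: Suc mult.assoc distrib_right)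
    also have "of_nat (Suc e) * u = u * of_nat (Suc e)" by (rule mult_of_nat_commute)
    also have "u ^ e * (u * d * u + u * of_nat (Suc e)) = u ^ e * u * (u * d + 1 + of_nat (Suc e))"
      by (simp only: Eu distrib_left mult.assoc[of _ u])
    finally show ?case by (simp add: power_Suc2 add_ac del: power_Suc)
  qed (simp add: du)
  show "u * d ^ Suc e = d ^ e * (u * d - of_nat e)"
  proof (induction e)
    case (Suc e)
    have "u * d ^ Suc (Suc e) = u * d ^ Suc e * d" by (simp only: power_Suc2 mult.assoc)
    also have "\<dots> = d ^ e * (u * d * d - of_nat e * d)"
      by (simp only: Suc mult.assoc left_diff_distrib)
    also have "u * d * d = d * (u * d) - d" by (simp add: dE distrib_right)
    also have "of_nat e * d = d * of_nat e" by (rule mult_of_nat_commute)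
    also have "d ^ e * (d * (u * d) - d - d * of_nat e) = d ^ e * d * (u * d - 1 - of_nat e)"
      by (simp add: right_diff_distrib mult.assoc)
    finally show ?case by (simp add: power_Suc2 algebra_simps del: power_Suc)
  qed simp
qed

definition shifted_prod :: "'a::ring_1 \<Rightarrow> int multiset \<Rightarrow> 'a" where
  "shifted_prod a M = fold_mset (\<lambda>h x. (a + of_int h) * x) 1 M"

lemma shifted_prod_empty [simp]: "shifted_prod a {#} = 1"
  by (simp add: shifted_prod_def)

text \<open>Integers are central, so all factors \<open>a + of_int h\<close> commute and the fold
  does not depend on the order.\<close>

lemma shifted_prod_add_mset [simp]:
  "shifted_prod a (add_mset h M) = (a + of_int h) * shifted_prod a M"
proof -
  have "(a + of_int h) * (a + of_int k) = (a + of_int k) * (a + of_int h)" for h k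
    using mult_of_int_commute[of h a] mult_of_int_commute[of k a]
      mult_of_int_commute[of h "of_int k :: 'a"]
    by (simp add: distrib_left distrib_right add_ac)
  then have "(a + of_int h) * ((a + of_int k) * x) = (a + of_int k) * ((a + of_int h) * x)" for h k x
    by (simp flip: mult.assoc)
  then interpret comp_fun_commute "\<lambda>h x. (a + of_int h) * x"
    by unfold_locales (simp add: fun_eq_iff)
  show ?thesis by (simp add: shifted_prod_def)
qed

text \<open>A letter leading away from the axis lengthens the power in front; one leading towards it
  is traded by \<open>commute_power\<close> for the factor of the newly recorded level.\<close>

lemma phi_eq_levels:
  fixes E :: "'k::idom weyl"
  defines "E \<equiv> weyl_letter U * weyl_letter D"
  shows "phi w = (if 0 \<le> height w then weyl_letter U ^ nat (height w)
    else weyl_letter D ^ nat (- height w)) * shifted_prod E (levels w)"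
proof (induction w)
  case Nil
  then show ?case by (simp add: phi_def)
next
  case (Cons c w)
  define d u where "d = (weyl_letter D :: 'k weyl)" and "u = (weyl_letter U :: 'k weyl)"
  have du: "d * u = u * d + 1"
    using weyl_relation[where 'k = 'k] by (simp add: d_def u_def algebra_simps)
  note commute = commute_power[OF du]
  define P where "P = shifted_prod E (levels w)"
  note IH = Cons[folded d_def u_def P_def]
  have E: "E = u * d" by (simp add: E_def d_def u_def)
  show ?case
  proof (cases c)
    case c: D
    show ?thesis
    proof (cases "0 < height w")
      case True
      then obtain e where e: "nat (height w) = Suc e"
        by (metis gr0_implies_Suc zero_less_nat_eq)
      then have "height w = int (Suc e)" by linarith
      then have "nat (height w - 1) = e" and "of_int (height w) = (of_nat (Suc e) :: 'k weyl)"
        by (simp, simp only: of_int_of_nat_eq)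
      have "d * (u ^ Suc e * P) = u ^ e * ((u * d + of_nat (Suc e)) * P)"
        by (simp only: commute flip: mult.assoc)
      then show ?thesis
        using IH e True \<open>nat (height w - 1) = e\<close> \<open>of_int (height w) = of_nat (Suc e)\<close>
        by (simp add: c phi_Cons E d_def[symmetric] u_def[symmetric] P_def
            del: power_Suc of_nat_Suc)
    next
      case False
      then have "nat (- (height w - 1)) = Suc (nat (- height w))" by simp
      then show ?thesis
        using IH False
        \<comment> \<open>At height 0 the hypothesis is in the \<open>U\<close> branch, with
          exponent 0, but the goal is in the \<open>D\<close> branch.\<close>
        by (cases "height w = 0")
          (simp_all add: c phi_Cons d_def[symmetric] u_def[symmetric] P_def mult.assoc)
    qed
  next
    case c: U
    show ?thesis
    proof (cases "height w < 0")
      case True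
      then obtain e where e: "nat (- height w) = Suc e"
        by (metis gr0_implies_Suc zero_less_nat_eq neg_0_less_iff_less)
      then have e': "height w + 1 = - int e" by linarith
      have "nat (- (height w + 1)) = e" and "of_int (height w + 1) = (- of_nat e :: 'k weyl)"
        and "0 \<le> height w + 1 \<longleftrightarrow> e = 0"
        unfolding e' by simp_all
      have "u * (d ^ Suc e * P) = d ^ e * ((u * d - of_nat e) * P)"
        by (simp only: commute flip: mult.assoc)
      then show ?thesis
        using IH True e \<open>nat (- (height w + 1)) = e\<close> \<open>0 \<le> height w + 1 \<longleftrightarrow> e = 0\<close>
          \<open>of_int (height w + 1) = - of_nat e\<close>
        by (simp add: c phi_Cons E d_def[symmetric] u_def[symmetric] P_def
            del: power_Suc of_int_add minus_add_distrib)
    next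
      case False
      then have "nat (height w + 1) = Suc (nat (height w))" by simp
      then show ?thesis
        using IH False
        by (simp add: c phi_Cons d_def[symmetric] u_def[symmetric] P_def mult.assoc)
    qed
  qed
qed

lemma phi_eq_iff_levels_eq:
  assumes "height u = height v"
  shows "phi u = (phi v :: 'k::field_char_0 weyl) \<longleftrightarrow> levels u = levels v"
  using phi_eq_imp_levels_eq[OF _ assms, where 'k = 'k] assms
  by (auto simp: phi_eq_levels[of u] phi_eq_levels[of v])

section \<open>Counting level multisets\<close>

text \<open>
  Levels between the axis and the final height \<open>e\<close> are crossed by every path and may be recorded
  any number of times; beyond them a path cannot skip a level.
\<close>

definition connected_levels :: "int \<Rightarrow> int multiset \<Rightarrow> bool" where
  "connected_levels e F \<longleftrightarrow>
    (\<forall>h\<in>#F. max 0 e + 1 < h \<longrightarrow> h - 1 \<in># F) \<and> (\<forall>h\<in>#F. h < min 0 e \<longrightarrow> h + 1 \<in># F)"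

text \<open>A step down from \<open>e > 0\<close> lowers the threshold, so \<open>e + 1\<close> now
  requires \<open>e\<close>, which this very step records. Below the axis the situation is
  symmetric.\<close>

lemma connected_levels_levels: "connected_levels (height w) (levels w)"
proof (induction w)
  case (Cons c w)
  then show ?case
    by (cases c) (auto simp: connected_levels_def split: if_splits)
qed (simp add: connected_levels_def)

text \<open>A step towards the axis records a level and lowers the absolute height by 1; a step away
  only raises the latter.\<close>

lemma length_eq_levels: "int (length w) = 2 * int (size (levels w)) + \<bar>height w\<bar>"
  by (induction w) (auto split: letter.split)

text \<open>Mirroring a path in the axis turns a step between \<open>h - 1\<close> and
  \<open>h\<close> into one between \<open>- h\<close> and \<open>1 - h\<close>, whose upper end is
  \<open>1 - h\<close>.\<close>

definition reflect :: "int multiset \<Rightarrow> int multiset" where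
  "reflect = image_mset (\<lambda>h. 1 - h)"

lemma reflect_reflect [simp]: "reflect (reflect F) = F"
  by (simp add: reflect_def image_mset.compositionality o_def)

lemma inj_on_reflect: "inj_on reflect X"
  by (metis inj_onI reflect_reflect)

lemma size_reflect [simp]: "size (reflect F) = size F"
  by (simp add: reflect_def)

lemma mem_reflect [simp]: "h \<in># reflect F \<longleftrightarrow> 1 - h \<in># F"
  by (auto simp: reflect_def image_iff intro!: bexI[of _ "1 - h"])

lemma connected_levels_reflect:
  "connected_levels (- e) (reflect F) \<longleftrightarrow> connected_levels e F"
proof -
  have ball: "(\<forall>h\<in>#reflect F. P h) \<longleftrightarrow> (\<forall>h\<in>#F. P (1 - h))" for P
    by (simp add: reflect_def)
  have *: "max 0 (- e) + 1 < 1 - h \<longleftrightarrow> h < min 0 e"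
    "1 - h < min 0 (- e) \<longleftrightarrow> max 0 e + 1 < h" "1 - (1 - h - 1) = h + 1" "1 - (1 - h + 1) = h - 1" for h
    by auto
  show ?thesis
    unfolding connected_levels_def ball mem_reflect * by blast
qed

lemma connected_levels_nonpos:
  assumes F: "connected_levels 0 F" "1 \<notin># F" and h: "h \<in># F"
  shows "h \<le> 0"
proof (rule ccontr)
  have "int (Suc n) \<notin># F" for n
  proof (induction n)
    case (Suc n)
    have "int (Suc (Suc n)) - 1 = int (Suc n)" "max 0 0 + 1 < int (Suc (Suc n))" by simp_all
    with Suc F(1) show ?case unfolding connected_levels_def by metis
  qed (use F in simp)
  from this[of "nat (h - 1)"] show "\<not> h \<le> 0 \<Longrightarrow> False" using h by simp
qed

text \<open>Apply \<open>connected_levels_nonpos\<close> to \<open>F\<close> and to its reflection: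
  a level would be both at most 0 and at least 1.\<close>

lemma connected_levels_eq_empty:
  assumes "connected_levels 0 F" "0 \<notin># F" "1 \<notin># F"
  shows "F = {#}"
proof -
  have False if h: "h \<in># F" for h
  proof -
    have "1 - h \<in># reflect F" using h by simp
    moreover have "1 \<notin># reflect F" using assms by simp
    ultimately have "1 - h \<le> 0"
      using connected_levels_reflect[of 0 F] assms connected_levels_nonpos by (metis minus_zero)
    moreover have "h \<le> 0" using connected_levels_nonpos assms h by blast
    ultimately show False by simp
  qed
  then show ?thesis by blast
qed

text \<open>The path is built from its last step, the head of the list, by induction on its
  prospective length. It arrives from outside if that step's level is available, and otherwise from
  the side of the axis.\<close>

lemma connected_levels_realizable:
  assumes "connected_levels e F"
  shows "\<exists>w. height w = e \<and> levels w = F"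
  using assms
proof (induction "2 * size F + nat \<bar>e\<bar>" arbitrary: e F rule: less_induct)
  case less
  note conn = less.prems
  have last_D: ?case if "0 \<le> e" "e + 1 \<in># F"
  proof -
    from that(2) obtain G where G: "F = add_mset (e + 1) G" by (meson mset_add)
    \<comment> \<open>Even if the last copy of \<open>e + 1\<close> is gone, level
      \<open>e + 2\<close> no longer needs it.\<close>
    have "connected_levels (e + 1) G"
      using conn that(1) unfolding connected_levels_def G by force
    then obtain w where "height w = e + 1" "levels w = G"
      using less.hyps[of G "e + 1"] that(1) G by fastforce
    then show ?thesis using that(1) by (intro exI[of _ "D # w"]) (simp add: G)
  qed
  have last_U: ?case if "e \<le> 0" "e \<in># F"
  proof -
    from that(2) obtain G where G: "F = add_mset e G" by (meson mset_add)
    have "connected_levels (e - 1) G"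
      using conn that(1) unfolding connected_levels_def G by force
    then obtain w where "height w = e - 1" "levels w = G"
      using less.hyps[of G "e - 1"] that(1) G by fastforce
    then show ?thesis using that(1) by (intro exI[of _ "U # w"]) (simp add: G)
  qed
  consider "0 < e" | "e < 0" | "e = 0" by linarith
  then show ?case
  proof cases
    case 1
    show ?thesis
    proof (cases "e + 1 \<in># F")
      case False
      then have "connected_levels (e - 1) F"
        using conn 1 unfolding connected_levels_def
        by (smt (verit))
      then obtain w where "height w = e - 1" "levels w = F"
        using less.hyps[of F "e - 1"] 1 by auto
      then show ?thesis using 1 by (intro exI[of _ "U # w"]) simp
    qed (use last_D 1 in simp)
  next
    case 2
    show ?thesis
    proof (cases "e \<in># F")
      case False
      then have "connected_levels (e + 1) F"
        using conn 2 unfolding connected_levels_def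
        by (smt (verit))
      then obtain w where "height w = e + 1" "levels w = F"
        using less.hyps[of F "e + 1"] 2 by auto
      then show ?thesis using 2 by (intro exI[of _ "D # w"]) simp
    qed (use last_U 2 in simp)
  next
    case 3
    then consider "1 \<in># F" | "0 \<in># F" | "F = {#}"
      using connected_levels_eq_empty conn by blast
    then show ?thesis
    proof cases
      assume "F = {#}"
      then show ?thesis using 3 by (intro exI[of _ "[]"]) simp
    qed (use last_D last_U 3 in auto)
  qed
qed

text \<open>The flag \<open>b = False\<close> restricts to positive levels; reflection reduces part
  of the case \<open>b = True\<close>, \<open>e = 0\<close> to it.\<close>

definition level_sets :: "bool \<Rightarrow> nat \<Rightarrow> nat \<Rightarrow> int multiset set" where
  "level_sets b e k =
    {F. connected_levels (int e) F \<and> size F = k \<and> (b \<or> (\<forall>h\<in>#F. 0 < h))}"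

lemma finite_level_sets: "finite (level_sets b e k)"
proof (rule finite_subset)
  show "level_sets b e k \<subseteq> levels ` {w. set w \<subseteq> {D, U} \<and> length w = 2 * k + e}"
  proof
    fix F assume F: "F \<in> level_sets b e k"
    then obtain w where w: "height w = int e" "levels w = F"
      unfolding level_sets_def using connected_levels_realizable by blast
    then have "length w = 2 * k + e"
      using length_eq_levels[of w] F by (auto simp: level_sets_def)
    moreover have "set w \<subseteq> {D, U}"
      using letter.exhaust by blast
    ultimately show "F \<in> levels ` {w. set w \<subseteq> {D, U} \<and> length w = 2 * k + e}"
      using w by auto
  qed
  show "finite (levels ` {w. set w \<subseteq> {D, U} \<and> length w = 2 * k + e})"
    by (intro finite_imageI finite_lists_length_eq) simp
qed

lemma level_sets_0 [simp]: "level_sets b e 0 = {{#}}"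
  by (auto simp: level_sets_def connected_levels_def)

section \<open>Recursions from splitting on the presence of one level\<close>

lemma card_split:
  assumes "finite A"
  shows "card A = card {x \<in> A. P x} + card {x \<in> A. \<not> P x}"
proof -
  have "A = {x \<in> A. P x} \<union> {x \<in> A. \<not> P x}" by blast
  then show ?thesis
    using assms card_Un_disjoint[of "{x \<in> A. P x}" "{x \<in> A. \<not> P x}"] by auto
qed

lemma card_mem_mset:
  "card {F \<in> X. a \<in># F} = card {F. add_mset a F \<in> X}"
proof -
  have "{F \<in> X. a \<in># F} = add_mset a ` {F. add_mset a F \<in> X}"
    by (auto dest: multi_member_split)
  then show ?thesis by (simp add: card_image inj_on_def)
qed

text \<open>Once one copy of level 1 is set aside, level 2 is always permitted and further copies of
  1 are free, as for final height 1.\<close>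

lemma card_level_sets_zero_mem:
  "card {F \<in> level_sets b 0 (Suc k). 1 \<in># F} = card (level_sets b 1 k)"
proof -
  have "connected_levels 0 (add_mset 1 F) \<longleftrightarrow> connected_levels 1 F" for F
    unfolding connected_levels_def by force
  then have "{F. add_mset 1 F \<in> level_sets b 0 (Suc k)} = level_sets b 1 k"
    by (simp add: level_sets_def)
  then show ?thesis by (simp only: card_mem_mset)
qed

lemma card_level_sets_Suc_mem:
  "card {F \<in> level_sets b (Suc e) (Suc k). int (Suc e) \<in># F} = card (level_sets b (Suc e) k)"
proof -
  have "connected_levels (int (Suc e)) (add_mset (int (Suc e)) F) \<longleftrightarrow>
      connected_levels (int (Suc e)) F" for F
    unfolding connected_levels_def by force
  then have "{F. add_mset (int (Suc e)) F \<in> level_sets b (Suc e) (Suc k)} = level_sets b (Suc e) k"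
    unfolding level_sets_def by simp
  then show ?thesis by (simp only: card_mem_mset)
qed

text \<open>Deleting the unused level \<open>e + 1\<close> closes the gap that it leaves.\<close>

lemma card_level_sets_Suc_not_mem:
  "card {F \<in> level_sets b (Suc e) k. int (Suc e) \<notin># F} = card (level_sets b e k)"
proof -
  define s where "s = (\<lambda>h. if int e < h then h + 1 else h)"
  have inj: "inj s" by (auto simp: inj_def s_def split: if_splits)
  have mem: "s h \<in># image_mset s F \<longleftrightarrow> h \<in># F" for h F
    using inj by (auto dest: injD)
  have range: "h \<in> range s" if "h \<noteq> int (Suc e)" for h
  proof (cases "h \<le> int e")
    case True
    then have "h = s h" by (simp add: s_def)
    then show ?thesis by blast
  next
    case False
    with that have "h = s (h - 1)" by (auto simp: s_def)
    then show ?thesis by blast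
  qed
  \<comment> \<open>Beyond the threshold also \<open>h - 1 > int e\<close>, so
    \<open>s h - 1 = s (h - 1)\<close>.\<close>
  have up: "(max 0 (int (Suc e)) + 1 < s h \<longrightarrow> s h - 1 \<in># image_mset s F) \<longleftrightarrow>
      (max 0 (int e) + 1 < h \<longrightarrow> h - 1 \<in># F)" for h F
    using mem[of "h - 1" F] by (auto simp: s_def simp del: set_image_mset)
  have down: "(s h < min 0 (int (Suc e)) \<longrightarrow> s h + 1 \<in># image_mset s F) \<longleftrightarrow>
      (h < min 0 (int e) \<longrightarrow> h + 1 \<in># F)" for h F
    using mem[of "h + 1" F] by (auto simp: s_def simp del: set_image_mset)
  have ball: "(\<forall>h\<in>#image_mset s F. P h) \<longleftrightarrow> (\<forall>h\<in>#F. P (s h))" for P F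
    by simp
  have conn: "connected_levels (int (Suc e)) (image_mset s F) \<longleftrightarrow> connected_levels (int e) F" for F
    unfolding connected_levels_def ball up down ..
  have pos: "0 < s h \<longleftrightarrow> 0 < h" for h by (simp add: s_def)
  have iff: "image_mset s F \<in> level_sets b (Suc e) k \<longleftrightarrow> F \<in> level_sets b e k" for F
    unfolding level_sets_def by (simp only: mem_Collect_eq conn) (simp add: pos)
  have "{F \<in> level_sets b (Suc e) k. int (Suc e) \<notin># F} = image_mset s ` level_sets b e k"
  proof (intro equalityI subsetI)
    fix F assume F: "F \<in> {F \<in> level_sets b (Suc e) k. int (Suc e) \<notin># F}"
    have "s (inv s h) = h" if "h \<in># F" for h
      using F range[of h] that by (intro f_inv_into_f) auto
    then have "F = image_mset s (image_mset (inv s) F)"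
      by (simp add: image_mset.compositionality cong: image_mset_cong)
    then show "F \<in> image_mset s ` level_sets b e k"
      using F iff by (metis (no_types, lifting) imageI mem_Collect_eq)
  next
    fix F assume "F \<in> image_mset s ` level_sets b e k"
    then show "F \<in> {F \<in> level_sets b (Suc e) k. int (Suc e) \<notin># F}"
      using iff by (auto simp: s_def split: if_splits)
  qed
  moreover have "inj (image_mset s)" using inj by (rule multiset.inj_map)
  ultimately show ?thesis by (simp add: card_image inj_on_subset)
qed

text \<open>Without level 1 all levels are at most 0, and reflection makes them positive. If they
  also had to be positive, only the empty multiset would remain.\<close>

lemma card_level_sets_zero_not_mem:
  "card {F \<in> level_sets b 0 (Suc k). 1 \<notin># F} = (if b then card (level_sets False 0 (Suc k)) else 0)"
proof (cases b)
  case True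
  have conn: "connected_levels 0 (reflect F) \<longleftrightarrow> connected_levels 0 F" for F
    using connected_levels_reflect[of 0 F] by simp
  have "{F \<in> level_sets True 0 (Suc k). 1 \<notin># F} = reflect ` level_sets False 0 (Suc k)"
  proof (intro equalityI subsetI)
    fix F assume F: "F \<in> {F \<in> level_sets True 0 (Suc k). 1 \<notin># F}"
    then have "h \<le> 0" if "h \<in># F" for h
      using connected_levels_nonpos that by (auto simp: level_sets_def)
    then have "reflect F \<in> level_sets False 0 (Suc k)"
      using F conn[of F] by (force simp: level_sets_def)
    then show "F \<in> reflect ` level_sets False 0 (Suc k)"
      by (metis reflect_reflect imageI)
  next
    fix F assume "F \<in> reflect ` level_sets False 0 (Suc k)"
    then obtain G where G: "F = reflect G" "G \<in> level_sets False 0 (Suc k)" by blast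
    then show "F \<in> {F \<in> level_sets True 0 (Suc k). 1 \<notin># F}"
      using conn[of G] by (auto simp: level_sets_def)
  qed
  then show ?thesis using True by (simp add: card_image inj_on_reflect)
next
  case False
  have "{F \<in> level_sets False 0 (Suc k). 1 \<notin># F} = {}"
    using connected_levels_eq_empty by (fastforce simp: level_sets_def)
  then show ?thesis using False by (simp only: card.empty if_False)
qed

text \<open>A Pascal-type recursion: each additional free level contributes a factor
  \<open>1 / (1 - y)\<close>.\<close>

lemma card_level_sets_Suc_Suc:
  "card (level_sets b (Suc e) (Suc k)) = card (level_sets b (Suc e) k) + card (level_sets b e (Suc k))"
  using card_split[OF finite_level_sets, of b "Suc e" "Suc k" "\<lambda>F. int (Suc e) \<in># F"]
  by (simp only: card_level_sets_Suc_mem card_level_sets_Suc_not_mem)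

lemma card_level_sets_zero_Suc:
  "card (level_sets b 0 (Suc k)) =
    card (level_sets b 1 k) + (if b then card (level_sets False 0 (Suc k)) else 0)"
  using card_split[OF finite_level_sets, of b 0 "Suc k" "\<lambda>F. 1 \<in># F"]
  by (simp only: card_level_sets_zero_mem card_level_sets_zero_not_mem)

section \<open>From classes of words to level multisets\<close>

lemma card_image_eq_if_same_kernel:
  assumes "\<And>x y. x \<in> A \<Longrightarrow> y \<in> A \<Longrightarrow> f x = f y \<longleftrightarrow> g x = g y"
  shows "card (f ` A) = card (g ` A)"
proof -
  define h where "h = f \<circ> inv_into A g"
  have h: "h (g x) = f x" if "x \<in> A" for x
    unfolding h_def comp_apply
    using assms[of "inv_into A g (g x)" x] that by (simp add: f_inv_into_f inv_into_into)
  then have "f ` A = h ` g ` A"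
    by (auto simp: image_image)
  moreover have "inj_on h (g ` A)"
    using assms h by (auto simp: inj_on_def)
  ultimately show ?thesis by (simp add: card_image)
qed

lemma count_list_length:
  "count_list w D + count_list w U = length w"
  by (induction w) (auto split: letter.split, metis letter.exhaust)

lemma height_eq: "height w = int (count_list w U) - int (count_list w D)"
  by (induction w) (auto split: letter.split)

text \<open>The size \<open>min k (n - k)\<close> is half of \<open>n - \<bar>n - 2 k\<bar>\<close>,
  by \<open>length_eq_levels\<close>.\<close>

lemma levels_image:
  assumes "k \<le> n"
  shows "levels ` {w. count_list w D = k \<and> count_list w U = n - k} =
    {F. connected_levels (int n - 2 * int k) F \<and> size F = min k (n - k)}"
proof (intro equalityI subsetI)
  fix F assume "F \<in> levels ` {w. count_list w D = k \<and> count_list w U = n - k}"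
  then obtain w where w: "F = levels w" "count_list w D = k" "count_list w U = n - k" by blast
  then have "height w = int n - 2 * int k" "length w = n"
    using assms height_eq[of w] count_list_length[of w] by auto
  then show "F \<in> {F. connected_levels (int n - 2 * int k) F \<and> size F = min k (n - k)}"
    using connected_levels_levels[of w] length_eq_levels[of w] assms w(1) by auto
next
  fix F assume F: "F \<in> {F. connected_levels (int n - 2 * int k) F \<and> size F = min k (n - k)}"
  then obtain w where w: "height w = int n - 2 * int k" "levels w = F"
    using connected_levels_realizable by blast
  then have "length w = n"
    using length_eq_levels[of w] F assms by auto
  then have "count_list w D = k" "count_list w U = n - k"
    using w height_eq[of w] count_list_length[of w] by auto
  with w show "F \<in> levels ` {w. count_list w D = k \<and> count_list w U = n - k}" by blast
qed

lemma card_connected_levels_uminus: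
  "card {F. connected_levels (- e) F \<and> size F = k} = card {F. connected_levels e F \<and> size F = k}"
proof -
  have "{F. connected_levels (- e) F \<and> size F = k} = reflect ` {F. connected_levels e F \<and> size F = k}"
  proof (intro equalityI subsetI)
    fix F assume F: "F \<in> {F. connected_levels (- e) F \<and> size F = k}"
    then have "reflect F \<in> {F. connected_levels e F \<and> size F = k}"
      using connected_levels_reflect[of "- e" F] by simp
    then show "F \<in> reflect ` {F. connected_levels e F \<and> size F = k}"
      by (metis reflect_reflect imageI)
  qed (use connected_levels_reflect in auto)
  then show ?thesis by (simp add: card_image inj_on_reflect)
qed

lemma num_weyl_classes_eq_card:
  assumes "k \<le> n"
  shows "num_weyl_classes TYPE('k::field_char_0) n k =
    card {F. connected_levels (int n - 2 * int k) F \<and> size F = min k (n - k)}"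
proof -
  define A where "A = {w. count_list w D = k \<and> count_list w U = n - k}"
  have "A // weyl_equiv TYPE('k) = (\<lambda>u. {v. phi u = (phi v :: 'k weyl)}) ` A"
    by (auto simp: quotient_def weyl_equiv_def)
  also have "card \<dots> = card (levels ` A)"
  proof (rule card_image_eq_if_same_kernel)
    fix u v assume "u \<in> A" "v \<in> A"
    then have "phi u = (phi v :: 'k weyl) \<longleftrightarrow> levels u = levels v"
      by (intro phi_eq_iff_levels_eq) (simp add: height_eq A_def)
    then show "{w. phi u = (phi w :: 'k weyl)} = {w. phi v = (phi w :: 'k weyl)} \<longleftrightarrow> levels u = levels v"
      by auto
  qed
  finally show ?thesis
    using levels_image[OF assms] by (simp add: num_weyl_classes_def A_def)
qed

lemma num_weyl_classes_le:
  assumes "2 * k \<le> n"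
  shows "num_weyl_classes TYPE('k::field_char_0) n k = card (level_sets True (n - 2 * k) k)"
proof -
  have "int n - 2 * int k = int (n - 2 * k)" "min k (n - k) = k" using assms by auto
  then show ?thesis
    using assms by (simp add: num_weyl_classes_eq_card level_sets_def)
qed

lemma num_weyl_classes_gt:
  assumes "n < 2 * k" "k \<le> n"
  shows "num_weyl_classes TYPE('k::field_char_0) n k = card (level_sets True (2 * k - n) (n - k))"
proof -
  have "int n - 2 * int k = - int (2 * k - n)" "min k (n - k) = n - k" using assms by auto
  then show ?thesis
    using assms
    by (simp only: num_weyl_classes_eq_card level_sets_def card_connected_levels_uminus) simp
qed

section \<open>Generating functions\<close>

abbreviation ser_y :: "rat fps fps" where "ser_y \<equiv> ser_t * ser_x ^ 2"

lemma nth_ser_x_mult: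
  "fps_nth (fps_nth (ser_x * F) n) k = (if 0 < n then fps_nth (fps_nth F (n - 1)) k else 0)"
  by simp

lemma nth_ser_tx_mult:
  "fps_nth (fps_nth (ser_t * ser_x * F) n) k =
    (if 0 < n \<and> 0 < k then fps_nth (fps_nth F (n - 1)) (k - 1) else 0)"
  by (simp add: mult.assoc)

lemma nth_ser_y_mult:
  "fps_nth (fps_nth (ser_y * F) n) k =
    (if 2 \<le> n \<and> 0 < k then fps_nth (fps_nth F (n - 2)) (k - 1) else 0)"
  by (simp add: mult.assoc fps_X_power_mult_nth)

definition bivariate :: "(nat \<Rightarrow> nat \<Rightarrow> nat) \<Rightarrow> rat fps fps" where
  "bivariate a = Abs_fps (\<lambda>n. Abs_fps (\<lambda>k. of_nat (a n k)))"

lemma nth_bivariate [simp]: "fps_nth (fps_nth (bivariate a) n) k = of_nat (a n k)"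
  by (simp add: bivariate_def)

lemma bivariate_eq_sum:
  assumes "\<And>n. finite (K n)"
  shows "Abs_fps (\<lambda>n. \<Sum>k\<in>K n. of_nat (a n k) * var_t ^ k) =
    bivariate (\<lambda>n k. if k \<in> K n then a n k else 0)"
proof (intro fps_ext)
  fix n k
  have "(\<Sum>j\<in>K n. fps_nth (of_nat (a n j) * var_t ^ j) k) =
      (\<Sum>j\<in>K n. if j = k then of_nat (a n j) else 0)"
    by (intro sum.cong) (auto simp: fps_of_nat[symmetric])
  then show "fps_nth (fps_nth (Abs_fps (\<lambda>n. \<Sum>k\<in>K n. of_nat (a n k) * var_t ^ k)) n) k =
      fps_nth (fps_nth (bivariate (\<lambda>n k. if k \<in> K n then a n k else 0)) n) k"
    using assms by (simp add: fps_sum_nth)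
qed

text \<open>
  \<open>central b e\<close> is the generating function of \<open>card (level_sets b e k)\<close> in the variable
  \<open>y = t x\<^sup>2\<close>; its coefficients sit on the diagonal \<open>n = 2 k\<close>.
\<close>

definition central :: "bool \<Rightarrow> nat \<Rightarrow> rat fps fps" where
  "central b e = bivariate (\<lambda>n k. if n = 2 * k then card (level_sets b e k) else 0)"

lemma central_one: "central b 1 = ser_y * central b 1 + central b 0"
proof (intro fps_ext)
  fix n k
  show "fps_nth (fps_nth (central b 1) n) k =
      fps_nth (fps_nth (ser_y * central b 1 + central b 0) n) k"
    using card_level_sets_Suc_Suc[of b 0 "k - 1"]
    by (cases k) (auto simp: fps_add_nth nth_ser_y_mult central_def simp del: fps_mult_nth)
qed

lemma central_zero: "central b 0 = ser_y * central b 1 + (if b then central False 0 else 1)"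
proof (intro fps_ext)
  fix n k
  show "fps_nth (fps_nth (central b 0) n) k =
      fps_nth (fps_nth (ser_y * central b 1 + (if b then central False 0 else 1)) n) k"
    using card_level_sets_zero_Suc[of b "k - 1"]
    by (cases k) (auto simp: fps_add_nth nth_ser_y_mult central_def)
qed

lemma central_closed_form: "central True 0 * (1 - 2 * ser_y) ^ 2 = (1 - ser_y) ^ 2"
proof -
  define y where "y = ser_y"
  \<comment> \<open>Eliminating \<open>central False 1\<close> gives
    \<open>(1 - y) / (1 - 2 y)\<close>, the series of compositions: the multiplicities of levels 1,
    2, ... without gaps.\<close>
  have R: "central False 0 * (1 - 2 * y) = 1 - y"
    using central_one[of False] central_zero[of False] unfolding y_def[symmetric]
    by simp algebra
  have S: "central True 0 * (1 - 2 * y) = central False 0 * (1 - y)"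
    using central_one[of True] central_zero[of True] unfolding y_def[symmetric]
    by simp algebra
  have "central True 0 * (1 - 2 * y) ^ 2 = central False 0 * (1 - 2 * y) * (1 - y)"
    using S by algebra
  with R show ?thesis by (simp add: y_def power2_eq_square)
qed

section \<open>The two halves of the double series\<close>

definition lower_half :: "rat fps fps" where
  "lower_half = bivariate (\<lambda>n k. if 2 * k \<le> n then card (level_sets True (n - 2 * k) k) else 0)"

definition upper_half :: "rat fps fps" where
  "upper_half = bivariate
    (\<lambda>n k. if n < 2 * k \<and> k \<le> n then card (level_sets True (2 * k - n) (n - k)) else 0)"

text \<open>Multiplying by \<open>ser_x\<close> raises \<open>e = n - 2 * k\<close> by 1, and
  \<open>ser_y\<close> keeps \<open>e\<close> and adds a level. The recursion needs
  \<open>e > 0\<close>; the last summand corrects the diagonal.\<close>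

lemma lower_half_eq:
  "lower_half = ser_x * lower_half + ser_y * lower_half + (central True 0 - ser_y * central True 0)"
proof (intro fps_ext)
  fix n k
  consider "n < 2 * k" | "n = 2 * k" | e where "n = 2 * k + Suc e"
    by (metis less_imp_Suc_add linorder_cases add_Suc_right)
  then show "fps_nth (fps_nth lower_half n) k = fps_nth (fps_nth
      (ser_x * lower_half + ser_y * lower_half + (central True 0 - ser_y * central True 0)) n) k"
  proof cases
    case 1
    then show ?thesis
      by (simp only: fps_add_nth fps_sub_nth nth_ser_y_mult nth_ser_x_mult)
        (auto simp: lower_half_def central_def)
  next
    case 2
    then show ?thesis
      by (simp only: fps_add_nth fps_sub_nth nth_ser_y_mult nth_ser_x_mult)
        (auto simp: lower_half_def central_def)
  next
    case 3
    then show ?thesis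
      using card_level_sets_Suc_Suc[of True e "k - 1"]
      by (cases k) (simp_all only: fps_add_nth fps_sub_nth nth_ser_y_mult nth_ser_x_mult,
        auto simp: lower_half_def central_def)
  qed
qed

text \<open>Now \<open>ser_t * ser_x\<close> raises the excess \<open>2 * k - n\<close>, and the
  entries of excess 1 start from the diagonal series \<open>central True 0\<close>.\<close>

lemma upper_half_eq:
  "upper_half = ser_t * ser_x * upper_half + ser_y * upper_half + ser_t * ser_x * central True 0"
proof (intro fps_ext)
  fix n k
  show "fps_nth (fps_nth upper_half n) k = fps_nth (fps_nth
      (ser_t * ser_x * upper_half + ser_y * upper_half + ser_t * ser_x * central True 0) n) k"
  proof (cases "n < 2 * k \<and> k \<le> n")
    case False
    then show ?thesis
      by (simp only: fps_add_nth nth_ser_y_mult nth_ser_tx_mult)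
        (auto simp: upper_half_def central_def)
  next
    case True
    define e j where "e = 2 * k - n - 1" and "j = n - k"
    then have "k = Suc (e + j)" "n = Suc (e + 2 * j)" using True by auto
    then show ?thesis
      using card_level_sets_Suc_Suc[of True e "j - 1"]
      by (cases j; cases e) (simp_all only: fps_add_nth nth_ser_y_mult nth_ser_tx_mult,
        auto simp: upper_half_def central_def)
  qed
qed

theorem theorem6p4:
  shows "Abs_fps (\<lambda>n. \<Sum>k\<le>n. of_nat (num_weyl_classes TYPE('k::field_char_0) n k) * var_t ^ k) =
      (1 - 3 * ser_t * ser_x ^ 2 + ser_t ^ 2 * ser_x ^ 4) * (1 - ser_t * ser_x ^ 2) ^ 2 /
      ((1 - ser_t * ser_x - ser_t * ser_x ^ 2) * (1 - ser_x - ser_t * ser_x ^ 2) *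
        (1 - 2 * ser_t * ser_x ^ 2) ^ 2)
    \<and> Abs_fps (\<lambda>n. \<Sum>k | 2 * k \<le> n. of_nat (num_weyl_classes TYPE('k) n k) * var_t ^ k) =
      (1 - ser_t * ser_x ^ 2) ^ 3 /
      ((1 - ser_x - ser_t * ser_x ^ 2) * (1 - 2 * ser_t * ser_x ^ 2) ^ 2)"
proof -
  let ?a = "num_weyl_classes TYPE('k)"
  have lower: "Abs_fps (\<lambda>n. \<Sum>k | 2 * k \<le> n. of_nat (?a n k) * var_t ^ k) = lower_half"
  proof -
    have "finite {k. 2 * k \<le> n}" for n :: nat by (rule finite_subset[of _ "{..n}"]) auto
    from bivariate_eq_sum[of "\<lambda>n. {k. 2 * k \<le> n}", OF this] show ?thesis
      by (auto simp: lower_half_def num_weyl_classes_le intro!: arg_cong[of _ _ bivariate])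
  qed
  have total: "Abs_fps (\<lambda>n. \<Sum>k\<le>n. of_nat (?a n k) * var_t ^ k) = lower_half + upper_half"
  proof (intro fps_ext)
    fix n k
    show "fps_nth (fps_nth (Abs_fps (\<lambda>n. \<Sum>k\<le>n. of_nat (?a n k) * var_t ^ k)) n) k =
        fps_nth (fps_nth (lower_half + upper_half) n) k"
      by (simp only: bivariate_eq_sum[of "\<lambda>n. {..n}"] finite_atMost)
        (auto simp: lower_half_def upper_half_def num_weyl_classes_le num_weyl_classes_gt)
  qed
  define t x where "t = ser_t" and "x = ser_x"
  have const:
    "fps_nth ((1 - t * x - t * x ^ 2) * (1 - x - t * x ^ 2) * (1 - 2 * t * x ^ 2) ^ 2) 0 = 1"
    "fps_nth ((1 - x - t * x ^ 2) * (1 - 2 * t * x ^ 2) ^ 2) 0 = 1"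
    by (simp_all add: t_def x_def fps_mult_nth_0 fps_nth_power_0)
  have C: "central True 0 * (1 - 2 * t * x ^ 2) ^ 2 = (1 - t * x ^ 2) ^ 2"
    using central_closed_form by (simp add: t_def x_def mult.assoc)
  have L: "lower_half * (1 - x - t * x ^ 2) = (1 - t * x ^ 2) * central True 0"
    using lower_half_eq[folded t_def x_def] by algebra
  have H: "upper_half * (1 - t * x - t * x ^ 2) = t * x * central True 0"
    using upper_half_eq[folded t_def x_def] by algebra
  have L': "lower_half * ((1 - x - t * x ^ 2) * (1 - 2 * t * x ^ 2) ^ 2) = (1 - t * x ^ 2) ^ 3"
    using L C by algebra
  have H': "upper_half * ((1 - t * x - t * x ^ 2) * (1 - 2 * t * x ^ 2) ^ 2) =
      t * x * (1 - t * x ^ 2) ^ 2"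
    using H C by algebra
  have "(lower_half + upper_half) *
      ((1 - t * x - t * x ^ 2) * (1 - x - t * x ^ 2) * (1 - 2 * t * x ^ 2) ^ 2) =
      (1 - t * x - t * x ^ 2) * (1 - t * x ^ 2) ^ 3 +
      (1 - x - t * x ^ 2) * (t * x * (1 - t * x ^ 2) ^ 2)"
    unfolding L'[symmetric] H'[symmetric] by algebra
  \<comment> \<open>With \<open>y = t * x ^ 2\<close> this is
    \<open>(1 - t x - y) (1 - y) + (1 - x - y) t x = 1 - 3 y + y ^ 2\<close>.\<close>
  also have "\<dots> = (1 - 3 * t * x ^ 2 + t ^ 2 * x ^ 4) * (1 - t * x ^ 2) ^ 2"
    by algebra
  finally have "(1 - 3 * t * x ^ 2 + t ^ 2 * x ^ 4) * (1 - t * x ^ 2) ^ 2 =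
      (lower_half + upper_half) *
      ((1 - t * x - t * x ^ 2) * (1 - x - t * x ^ 2) * (1 - 2 * t * x ^ 2) ^ 2)" by simp
  with L' const show ?thesis
    unfolding lower total t_def[symmetric] x_def[symmetric]
    by (metis fps_fps_divide_eq_iff)
qed

end
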